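(* Let $X$ be a partially ordered vector space. If $X$ contains net catching elements, then every order unit in $X$ is net catching.
   Context: A partially ordered vector space is a real vector space $X$ with a partial order $\leq$ such that $x\leq y$ implies $x+z\leq y+z$ and $\lambda x\leq\lambda y$ for all $z\in X$ and real $\lambda\geq 0$; $X_+=\{x\in X;\ x\geq 0\}$. For a net $(x_\alpha)_{\alpha\in A}$ in $X$ we write $x_\alpha\downarrow 0$ if the net is decreasing ($\alpha\leq\beta$ implies $x_\beta\leq x_\alpha$) and $\inf_{\alpha\in A} x_\alpha=0$. An element $y\in X$ is called net catching if for every net $(x_\alpha)_{\alpha\in A}$ in $X$ with $x_\alpha\downarrow 0$ there is $\alpha\in A$ with $x_\alpha\leq y$. An element $u\in X_+$ is an order unit if for every $x\in X$ there is $n\in\mathbb{N}$ with $x\leq nu$. *)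

theory Defs
  imports Complex_Main "HOL-Library.Lub_Glb"
begin

definition directed_on :: "'i set \<Rightarrow> ('i \<Rightarrow> 'i \<Rightarrow> bool) \<Rightarrow> bool" where
  "directed_on A r \<longleftrightarrow> A \<noteq> {} \<and> reflp_on A r \<and> transp_on A r
     \<and> (\<forall>\<alpha>\<in>A. \<forall>\<beta>\<in>A. \<exists>\<gamma>\<in>A. r \<alpha> \<gamma> \<and> r \<beta> \<gamma>)"

(* \<open>r \<alpha> \<beta>\<close> stands for "\<alpha> \<le> \<beta>" in the index set A. *)
definition net_decreasing_to_0 ::
  "'i set \<Rightarrow> ('i \<Rightarrow> 'i \<Rightarrow> bool) \<Rightarrow> ('i \<Rightarrow> 'a::ordered_real_vector) \<Rightarrow> bool" where
  "net_decreasing_to_0 A r x \<longleftrightarrow> directed_on A r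
     \<and> (\<forall>\<alpha>\<in>A. \<forall>\<beta>\<in>A. r \<alpha> \<beta> \<longrightarrow> x \<beta> \<le> x \<alpha>) \<and> isGlb UNIV (x ` A) 0"

(* A definition cannot quantify over index types, so the index sets here are arbitrary directed
   subsets of the type 'a itself, with an arbitrary preorder. This loses no generality: a
   decreasing net may be replaced by its range, indexed by itself with the reversed order.
   See net_catchingD for index sets of any type. *)
definition net_catching :: "'a::ordered_real_vector \<Rightarrow> bool" where
  "net_catching y \<longleftrightarrow>
     (\<forall>(A :: 'a set) r (x :: 'a \<Rightarrow> 'a). net_decreasing_to_0 A r x \<longrightarrow> (\<exists>\<alpha>\<in>A. x \<alpha> \<le> y))"

lemma net_catchingD:
  fixes x :: "'i \<Rightarrow> 'a::ordered_real_vector"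
  assumes "net_catching y" and "net_decreasing_to_0 A r x"
  shows "\<exists>\<alpha>\<in>A. x \<alpha> \<le> y"
proof -
  have A: "A \<noteq> {}" and dir: "\<And>\<alpha> \<beta>. \<alpha> \<in> A \<Longrightarrow> \<beta> \<in> A \<Longrightarrow> \<exists>\<gamma>\<in>A. r \<alpha> \<gamma> \<and> r \<beta> \<gamma>"
    and dec: "\<And>\<alpha> \<beta>. \<alpha> \<in> A \<Longrightarrow> \<beta> \<in> A \<Longrightarrow> r \<alpha> \<beta> \<Longrightarrow> x \<beta> \<le> x \<alpha>"
    and glb: "isGlb UNIV (x ` A) 0"
    using assms(2) unfolding net_decreasing_to_0_def directed_on_def by blast+
  have low: "\<exists>c\<in>x ` A. c \<le> a \<and> c \<le> b" if ab: "a \<in> x ` A" "b \<in> x ` A" for a b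
  proof -
    obtain \<alpha> \<beta> where i: "\<alpha> \<in> A" "a = x \<alpha>" "\<beta> \<in> A" "b = x \<beta>"
      using ab by (elim imageE)
    obtain \<gamma> where g: "\<gamma> \<in> A" "r \<alpha> \<gamma>" "r \<beta> \<gamma>"
      using dir[OF i(1,3)] by (elim bexE conjE)
    show ?thesis
      using g(1) dec[OF i(1) g(1,2)] dec[OF i(3) g(1,3)] i(2,4) by (intro bexI[of _ "x \<gamma>"]) simp_all
  qed
  have "directed_on (x ` A) (\<lambda>a b. b \<le> a)"
    unfolding directed_on_def reflp_on_def transp_on_def
  proof (intro conjI ballI impI)
    show "x ` A \<noteq> {}" using A by simp
  qed (simp, erule (1) order_trans[rotated], erule (1) low)
  hence "net_decreasing_to_0 (x ` A) (\<lambda>a b. b \<le> a) (\<lambda>a. a)"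
    using glb unfolding net_decreasing_to_0_def image_ident by blast
  with assms(1) have "\<exists>a\<in>x ` A. a \<le> y"
    unfolding net_catching_def by blast
  thus ?thesis by blast
qed

definition order_unit :: "'a::ordered_real_vector \<Rightarrow> bool" where
  "order_unit u \<longleftrightarrow> 0 \<le> u \<and> (\<forall>x. \<exists>n::nat. x \<le> real n *\<^sub>R u)"

end

theory Submission
  imports Defs
begin

text \<open>Let \<open>y\<close> be net catching and \<open>u\<close> an order unit, so
  \<open>y\<close> lies below \<open>c *\<^sub>R u\<close> for some c > 0. If a net x decreases to
  0, so does the stretched net c x (\<open>net_decreasing_to_0_scaleR\<close>). Hence
  \<open>y\<close> catches some member of it, which then lies below c u, and cancelling c puts the
  corresponding member of x below \<open>u\<close> (\<open>net_catching_descale\<close>).\<close>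

lemma isGlb_UNIV_0_iff:
  fixes f :: "'i \<Rightarrow> 'a::ordered_real_vector"
  shows "isGlb UNIV (f ` A) 0 \<longleftrightarrow>
    (\<forall>\<alpha>\<in>A. 0 \<le> f \<alpha>) \<and> (\<forall>z. (\<forall>\<alpha>\<in>A. z \<le> f \<alpha>) \<longrightarrow> z \<le> 0)"
  by (simp add: isGlb_def isLb_def greatestP_def setge_def setle_def)

text \<open>Multiplication by c > 0 is an order automorphism with inverse division by c, so it
  preserves monotonicity and infima.\<close>

lemma net_decreasing_to_0_scaleR:
  fixes x :: "'i \<Rightarrow> 'a::ordered_real_vector"
  assumes "net_decreasing_to_0 A r x" and "c > 0"
  shows "net_decreasing_to_0 A r (\<lambda>\<alpha>. c *\<^sub>R x \<alpha>)"
proof -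
  have lb: "\<And>\<alpha>. \<alpha> \<in> A \<Longrightarrow> 0 \<le> x \<alpha>"
    and greatest: "\<And>z. (\<And>\<alpha>. \<alpha> \<in> A \<Longrightarrow> z \<le> x \<alpha>) \<Longrightarrow> z \<le> 0"
    using assms(1) unfolding net_decreasing_to_0_def isGlb_UNIV_0_iff by blast+
  have "z \<le> 0" if "\<forall>\<alpha>\<in>A. z \<le> c *\<^sub>R x \<alpha>" for z
  proof -
    \<comment> \<open>Dividing by c turns a lower bound of the stretched net into one of the
      original net.\<close>
    have "z /\<^sub>R c \<le> 0"
      using that assms(2) by (intro greatest) (simp add: pos_divideR_le_eq)
    thus ?thesis
      using assms(2) by (simp add: pos_divideR_le_eq)
  qed
  moreover have "\<forall>\<alpha>\<in>A. 0 \<le> c *\<^sub>R x \<alpha>"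
    using lb assms(2) by (simp add: scaleR_nonneg_nonneg)
  ultimately show ?thesis
    using assms unfolding net_decreasing_to_0_def isGlb_UNIV_0_iff
    by (simp add: scaleR_left_mono)
qed

text \<open>Isolates what an order unit contributes: one positive multiple of it dominates
  \<open>y\<close>. The factor c is moved from \<open>u\<close> onto the net to be caught.\<close>

lemma net_catching_descale:
  fixes y u :: "'a::ordered_real_vector"
  assumes "net_catching y" and "y \<le> c *\<^sub>R u" and "c > 0"
  shows "net_catching u"
  unfolding net_catching_def
proof (intro allI impI)
  fix A :: "'a set" and r and x :: "'a \<Rightarrow> 'a"
  assume "net_decreasing_to_0 A r x"
  then obtain \<alpha> where "\<alpha> \<in> A" "c *\<^sub>R x \<alpha> \<le> y"
    using net_catchingD[OF assms(1) net_decreasing_to_0_scaleR] assms(3) by blast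
  moreover from this have "c *\<^sub>R x \<alpha> \<le> c *\<^sub>R u"
    using assms(2) by (blast intro: order_trans)
  ultimately show "\<exists>\<alpha>\<in>A. x \<alpha> \<le> u"
    using assms(3) by (auto simp: scaleR_le_cancel_left_pos)
qed

theorem proposition3p1:
  assumes "\<exists>y :: 'a::ordered_real_vector. net_catching y"
  shows "\<forall>u :: 'a. order_unit u \<longrightarrow> net_catching u"
proof (intro allI impI)
  fix u :: 'a
  assume u: "order_unit u"
  obtain y :: 'a where y: "net_catching y"
    using assms by blast
  obtain n :: nat where "y \<le> real n *\<^sub>R u"
    using u unfolding order_unit_def by blast
  \<comment> \<open>\<open>n\<close> may be 0, and the scaling factor has to be positive.\<close>
  also have "\<dots> \<le> real (Suc n) *\<^sub>R u"
    using u by (intro scaleR_right_mono) (simp_all add: order_unit_def)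
  finally show "net_catching u"
    by (rule net_catching_descale[OF y]) simp
qed

end
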